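(* Let $f,g$ be arbitrary functions and let $\{x\}=\{x_1,\dots,x_L\}$, $\{y\}=\{y_1,\dots,y_L\}$ be two arbitrary sets of $L$ parameters each. Then $$\mathcal{A}_{\{x\}\cup\{y\}}[f,g]=\frac{\widehat V(x_1-\frac\eta2,\dots,x_L-\frac\eta2)}{\widehat V(x_1+\frac\eta2,\dots,x_L+\frac\eta2)}\Big(1+\sum_{k=1}^LX^g_{f,k}\Big)\frac{\det_L\bar{\mathcal{S}}_{\mathbf{x},\mathbf{y}}[f,g]}{\widehat V(x_L,\dots,x_1)\,\widehat V(y_1,\dots,y_L)},$$ where $\bar{\mathcal{S}}_{\mathbf{x},\mathbf{y}}[f,g]$ is the $L\times L$ matrix with entries $$\big[\bar{\mathcal{S}}_{\mathbf{x},\mathbf{y}}[f,g]\big]_{i,k}=\sum_{\epsilon\in\{+,-\}}f(\epsilon y_i)X(y_i+\epsilon\eta)\Bigg[\frac{f(-x_k)}{\varsigma(y_i+\epsilon\frac\eta2)-\varsigma(x_k+\frac\eta2)}-\frac{f(x_k)\varphi_{\{x\}}(x_k)}{\varsigma(y_i+\epsilon\frac\eta2)-\varsigma(x_k-\frac\eta2)}$$ $$-\frac{f(-x_k)-f(x_k)\varphi_{\{x\}}(x_k)}{1+\sum_{\ell=1}^LX^g_{f,\ell}}\sum_{j=1}^L\frac{X^g_{f,j}}{\varsigma(y_i+\epsilon\frac\eta2)-\varsigma(x_j-\frac\eta2)}\Bigg]+\frac{g(y_i)}{X(y_i)}\,\frac{f(-x_k)-f(x_k)\varphi_{\{x\}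}(x_k)}{1+\sum_{\ell=1}^LX^g_{f,\ell}}.$$
   Context: $\eta\in\mathbb{C}$ is fixed, $\varsigma(\lambda)=\cosh(2\lambda)/2$, $\widehat V(z_1,\dots,z_n)=\prod_{j<k}(\sinh^2z_k-\sinh^2z_j)$. For variables $\{z_1,\dots,z_n\}$, $$\mathcal{A}_{\{z\}}[f,g]=\frac{\det_{1\le i,j\le n}\big[\sum_{\epsilon=\pm1}f(\epsilon z_i)\,\varsigma(z_i+\epsilon\eta/2)^{j-1}+\delta_{j,n}\,g(z_i)\big]}{\widehat V(z_1,\dots,z_n)}$$ (here $n=2L$ and $(z_1,\dots,z_{2L})=(x_1,\dots,x_L,y_1,\dots,y_L)$). Moreover $$X(\lambda)=\prod_{\ell=1}^L[\varsigma(\lambda)-\varsigma(x_\ell)],\quad X_k(\lambda)=\prod_{\ell\ne k}[\varsigma(\lambda)-\varsigma(x_\ell)],\quad \varphi_{\{x\}}(\lambda)=\frac{\sinh(2\lambda-\eta)}{\sinh(2\lambda+\eta)}\frac{X(\lambda+\eta)}{X(\lambda-\eta)},$$ $$X^g_{f,k}=-\frac{g(x_k)}{f(-x_k)\sinh(2x_k)\sinh\eta\,X_k(x_k)X_k(x_k-\eta)}=\frac{g(x_k)\sinh(2x_k-\eta)}{f(-x_k)X'(x_k)X(x_k-\eta)}.$$ All parameters are assumed such that no denominator vanishes. *)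

theory Defs
  imports Complex_Main "Jordan_Normal_Form.Determinant"
begin

(* A tuple (z_1,...,z_n) is a list of length n, so indices run from 0: z_i is zs ! (i - 1). *)

definition vsig :: "complex \<Rightarrow> complex" where
  "vsig l = cosh (2 * l) / 2"

definition Vhat :: "complex list \<Rightarrow> complex" where
  "Vhat zs = (\<Prod>k<length zs. \<Prod>j<k. (sinh (zs ! k))\<^sup>2 - (sinh (zs ! j))\<^sup>2)"

(* With 0-based column index j, the exponent j-1 becomes j and the Kronecker delta
   picks the column with j + 1 = n. *)
definition Adet ::
  "complex \<Rightarrow> complex list \<Rightarrow> (complex \<Rightarrow> complex) \<Rightarrow> (complex \<Rightarrow> complex) \<Rightarrow> complex" where
  "Adet \<eta> zs f g =
     det (mat (length zs) (length zs) (\<lambda>(i, j).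
       (\<Sum>\<epsilon>\<in>{1, -1}. f (\<epsilon> * zs ! i) * vsig (zs ! i + \<epsilon> * \<eta> / 2) ^ j)
       + (if j + 1 = length zs then g (zs ! i) else 0)))
     / Vhat zs"

definition Xfun :: "complex list \<Rightarrow> complex \<Rightarrow> complex" where
  "Xfun xs l = (\<Prod>m<length xs. vsig l - vsig (xs ! m))"

definition Xdel :: "complex list \<Rightarrow> nat \<Rightarrow> complex \<Rightarrow> complex" where
  "Xdel xs k l = (\<Prod>m\<in>{..<length xs} - {k}. vsig l - vsig (xs ! m))"

definition phi :: "complex \<Rightarrow> complex list \<Rightarrow> complex \<Rightarrow> complex" where
  "phi \<eta> xs l = sinh (2 * l - \<eta>) / sinh (2 * l + \<eta>) * (Xfun xs (l + \<eta>) / Xfun xs (l - \<eta>))"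

definition Xgf ::
  "complex \<Rightarrow> complex list \<Rightarrow> (complex \<Rightarrow> complex) \<Rightarrow> (complex \<Rightarrow> complex) \<Rightarrow> nat \<Rightarrow> complex" where
  "Xgf \<eta> xs f g k =
     - (g (xs ! k) / (f (- xs ! k) * sinh (2 * xs ! k) * sinh \<eta>
          * Xdel xs k (xs ! k) * Xdel xs k (xs ! k - \<eta>)))"

definition Sbar ::
  "complex \<Rightarrow> complex list \<Rightarrow> complex list \<Rightarrow> (complex \<Rightarrow> complex) \<Rightarrow> (complex \<Rightarrow> complex)
     \<Rightarrow> complex mat" where
  "Sbar \<eta> xs ys f g = mat (length xs) (length xs) (\<lambda>(i, k).
     (\<Sum>\<epsilon>\<in>{1, -1}. f (\<epsilon> * ys ! i) * Xfun xs (ys ! i + \<epsilon> * \<eta>) *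
        (f (- xs ! k) / (vsig (ys ! i + \<epsilon> * \<eta> / 2) - vsig (xs ! k + \<eta> / 2))
         - f (xs ! k) * phi \<eta> xs (xs ! k)
             / (vsig (ys ! i + \<epsilon> * \<eta> / 2) - vsig (xs ! k - \<eta> / 2))
         - (f (- xs ! k) - f (xs ! k) * phi \<eta> xs (xs ! k))
             / (1 + (\<Sum>l<length xs. Xgf \<eta> xs f g l))
           * (\<Sum>j<length xs. Xgf \<eta> xs f g j
               / (vsig (ys ! i + \<epsilon> * \<eta> / 2) - vsig (xs ! j - \<eta> / 2)))))
     + g (ys ! i) / Xfun xs (ys ! i)
       * ((f (- xs ! k) - f (xs ! k) * phi \<eta> xs (xs ! k))
          / (1 + (\<Sum>l<length xs. Xgf \<eta> xs f g l))))"

lemma vsig_diff: "vsig a - vsig b = sinh (a + b) * sinh (a - b)"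
proof -
  have "2 * a = (a + b) + (a - b)" "2 * b = (a + b) - (a - b)" by simp_all
  then show ?thesis
    unfolding vsig_def by (simp only: cosh_add cosh_diff) (simp add: field_simps)
qed

lemma Xfun_remove:
  assumes "k < length xs"
  shows "Xfun xs l = (vsig l - vsig (xs ! k)) * Xdel xs k l"
  unfolding Xfun_def Xdel_def using assms by (subst prod.remove[of _ k]) auto

lemma Xfun_has_derivative_at_root:
  assumes "k < length xs"
  shows "(Xfun xs has_field_derivative sinh (2 * xs ! k) * Xdel xs k (xs ! k)) (at (xs ! k))"
proof -
  have v: "(vsig has_field_derivative sinh (2 * l)) (at l)" for l
    unfolding vsig_def[abs_def] by (auto intro!: derivative_eq_intros)
  obtain D where D: "(Xdel xs k has_field_derivative D) (at (xs ! k))"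
  proof -
    have "\<exists>D. ((\<lambda>l. \<Prod>m\<in>M. vsig l - vsig (xs ! m)) has_field_derivative D) (at a)"
      if "finite M" for a and M :: "nat set"
      using that
    proof (induction M rule: finite_induct)
      case empty
      show ?case by (auto intro: derivative_intros)
    next
      case (insert m M)
      then obtain D where
        "((\<lambda>l. \<Prod>m\<in>M. vsig l - vsig (xs ! m)) has_field_derivative D) (at a)" by blast
      from DERIV_mult[OF DERIV_diff[OF v DERIV_const] this] show ?case
        using insert.hyps by auto
    qed
    from this[of "{..<length xs} - {k}"] show ?thesis
      using that unfolding Xdel_def[abs_def] by auto
  qed
  show ?thesis
    unfolding Xfun_remove[OF assms, abs_def]
    by (auto intro!: derivative_eq_intros v D)
qed

(* The second expression for X^g_{f,k}, in terms of X'. *)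
lemma Xgf_alt:
  assumes "k < length xs" "sinh (2 * xs ! k - \<eta>) \<noteq> 0"
    and "(Xfun xs has_field_derivative D) (at (xs ! k))"
  shows "Xgf \<eta> xs f g k =
    g (xs ! k) * sinh (2 * xs ! k - \<eta>) / (f (- xs ! k) * D * Xfun xs (xs ! k - \<eta>))"
proof -
  have D: "D = sinh (2 * xs ! k) * Xdel xs k (xs ! k)"
    using DERIV_unique[OF assms(3) Xfun_has_derivative_at_root[OF assms(1)]] .
  have "xs ! k - \<eta> + xs ! k = 2 * xs ! k - \<eta>" by simp
  then have X: "Xfun xs (xs ! k - \<eta>)
      = - (sinh (2 * xs ! k - \<eta>) * sinh \<eta> * Xdel xs k (xs ! k - \<eta>))"
    by (simp add: Xfun_remove[OF assms(1)] vsig_diff)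
  show ?thesis
    unfolding Xgf_def D X using assms(2) by (simp add: divide_simps)
qed

end

(* Each row of the 2L x 2L matrix is a linear functional on polynomials p of degree < 2L:
   f(z) p(vsig(z + eta/2)) + f(-z) p(vsig(z - eta/2)) + g(z) [top coefficient of p].
   Evaluate the functionals on the (monic) node polynomials with nodes a_k = vsig(x_k - eta/2)
   and b_k = vsig(x_k + eta/2). The rows of the x's then become diagonal matrices perturbed by
   the rank-one matrix of the g(x_i), with determinant a multiple of 1 + sum_k X^g_{f,k}, and the
   Schur complement in the rows of the y's is the matrix S-bar up to row and column factors.
   The change of basis has a Vandermonde determinant in the nodes. *)
theory Submission
  imports Defs
begin

section \<open>Vandermonde products of lists\<close>

lemma prod_lessThan_add:
  fixes h :: "nat \<Rightarrow> 'a::comm_monoid_mult"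
  shows "(\<Prod>j<a + b. h j) = (\<Prod>j<a. h j) * (\<Prod>j<b. h (a + j))"
  by (induction b) (simp_all add: mult.assoc)

text \<open>Same index pattern as \<open>Vhat\<close>, but in the entries themselves:
  \<open>Vhat\<close> becomes \<open>vdm\<close> of the \<open>vsig\<close> values, and the same
  product serves for the nodes, which are not of the form \<open>sinh\<close> squared.\<close>

definition vdm :: "'a::idom list \<Rightarrow> 'a" where
  "vdm zs = (\<Prod>k<length zs. \<Prod>j<k. zs ! k - zs ! j)"

lemma vdm_Nil [simp]: "vdm [] = 1"
  by (simp add: vdm_def)

lemma vdm_snoc: "vdm (zs @ [w]) = vdm zs * (\<Prod>j<length zs. w - zs ! j)"
  by (simp add: vdm_def nth_append)

lemma vdm_append:
  "vdm (xs @ ys) = vdm xs * vdm ys * (\<Prod>k<length ys. \<Prod>j<length xs. ys ! k - xs ! j)"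
proof (induction ys rule: rev_induct)
  case (snoc w ys)
  have "vdm (xs @ ys @ [w]) = vdm (xs @ ys) * (\<Prod>j<length xs + length ys. w - (xs @ ys) ! j)"
    using vdm_snoc[of "xs @ ys" w] by simp
  then show ?case
    unfolding prod_lessThan_add snoc.IH by (simp add: vdm_snoc nth_append)
qed simp

lemma prod_rev_nth: "(\<Prod>k<length zs. h (rev zs ! k)) = (\<Prod>k<length zs. h (zs ! k))"
  by (subst prod.nat_diff_reindex[symmetric]) (simp add: rev_nth)

lemma prod_minus_swap:
  fixes a b :: "'i \<Rightarrow> 'a::comm_ring_1"
  shows "(\<Prod>k\<in>A. a k - b k) = (-1) ^ card A * (\<Prod>k\<in>A. b k - a k)"
proof -
  have "(\<Prod>k\<in>A. a k - b k) = (\<Prod>k\<in>A. (-1) * (b k - a k))" by simp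
  then show ?thesis by (simp only: prod.distrib prod_constant)
qed

lemma vdm_rev_snoc:
  "vdm (rev (zs @ [w])) = vdm (rev zs) * (\<Prod>k<length zs. zs ! k - w)"
  using vdm_append[of "[w]" "rev zs"] prod_rev_nth[of "\<lambda>z. z - w" zs] vdm_snoc[of "[]" w]
  by simp

text \<open>Reversal flips the k differences that entry k forms with earlier entries. The sign stays
  an unevaluated product: what matters later is that it is nonzero and depends on the length
  alone.\<close>

lemma vdm_rev: "vdm (rev zs) = (\<Prod>k<length zs. (-1) ^ k) * vdm zs"
proof (induction zs rule: rev_induct)
  case (snoc w zs)
  then show ?case
    unfolding vdm_rev_snoc vdm_snoc prod_minus_swap[of _ "\<lambda>_. w"] by simp
qed simp

text \<open>Of the ordered pairs of distinct indices, those with m < k make up \<open>vdm zs\<close>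
  and those with m > k make up \<open>vdm (rev zs)\<close>.\<close>

lemma prod_differences_eq_vdm:
  "(\<Prod>k<length zs. \<Prod>m\<in>{..<length zs} - {k}. zs ! k - zs ! m) = vdm zs * vdm (rev zs)"
proof (induction zs rule: rev_induct)
  case (snoc w zs)
  let ?n = "length zs"
  have *: "(\<Prod>m\<in>{..<Suc ?n} - {k}. (zs @ [w]) ! k - (zs @ [w]) ! m) =
      (zs ! k - w) * (\<Prod>m\<in>{..<?n} - {k}. zs ! k - zs ! m)" if "k < ?n" for k
  proof -
    have "{..<Suc ?n} - {k} = insert ?n ({..<?n} - {k})" using that by auto
    moreover have "(\<Prod>m\<in>{..<?n} - {k}. zs ! k - (zs @ [w]) ! m)
        = (\<Prod>m\<in>{..<?n} - {k}. zs ! k - zs ! m)"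
      by (rule prod.cong) (auto simp: nth_append)
    ultimately show ?thesis using that by (simp add: nth_append)
  qed
  have **: "{..<Suc ?n} - {?n} = {..<?n}" by auto
  have "(\<Prod>k<Suc ?n. \<Prod>m\<in>{..<Suc ?n} - {k}. (zs @ [w]) ! k - (zs @ [w]) ! m) =
      (\<Prod>k<?n. (zs ! k - w) * (\<Prod>m\<in>{..<?n} - {k}. zs ! k - zs ! m)) * (\<Prod>m<?n. w - zs ! m)"
    unfolding prod.lessThan_Suc[of _ ?n] **
    by (intro arg_cong2[of _ _ _ _ "(*)"] prod.cong)
      (simp_all only: lessThan_iff *, simp_all add: nth_append)
  also have "\<dots> = vdm (zs @ [w]) * vdm (rev (zs @ [w]))"
    unfolding prod.distrib snoc.IH vdm_snoc vdm_rev_snoc by simp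
  finally show ?case by simp
qed simp

section \<open>Monic node polynomials and Vandermonde determinants\<close>

lemma poly_eq_sum_coeff:
  fixes p :: "'a::comm_semiring_1 poly"
  assumes "degree p < n"
  shows "(\<Sum>j<n. coeff p j * z ^ j) = poly p z"
  unfolding poly_altdef
  by (rule sum.mono_neutral_right) (use assms in \<open>auto simp: coeff_eq_0\<close>)

lemma
  fixes c :: "'i \<Rightarrow> 'a::idom"
  shows degree_prod_linear: "degree (\<Prod>m\<in>I. [:- c m, 1:]) = card I"
    and coeff_prod_linear_card: "coeff (\<Prod>m\<in>I. [:- c m, 1:]) (card I) = 1"
    and poly_prod_linear: "poly (\<Prod>m\<in>I. [:- c m, 1:]) z = (\<Prod>m\<in>I. z - c m)"
proof -
  show d: "degree (\<Prod>m\<in>I. [:- c m, 1:]) = card I"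
    by (cases "finite I") (simp_all add: degree_prod_eq_sum_degree)
  have "lead_coeff (\<Prod>m\<in>I. [:- c m, 1:]) = 1"
    by (simp add: lead_coeff_prod)
  then show "coeff (\<Prod>m\<in>I. [:- c m, 1:]) (card I) = 1" by (simp add: d)
  show "poly (\<Prod>m\<in>I. [:- c m, 1:]) z = (\<Prod>m\<in>I. z - c m)"
    by (simp add: poly_prod)
qed

text \<open>Induction on the last node: a unitriangular column operation leaves a block triangular
  matrix whose corner is exactly the factor that \<open>vdm_snoc\<close> adds.\<close>

lemma det_vandermonde:
  fixes zs :: "'a::idom list"
  shows "det (mat (length zs) (length zs) (\<lambda>(i, j). zs ! i ^ j)) = vdm zs"
proof (induction zs rule: rev_induct)
  case (snoc w zs)
  define n where "n = length zs"
  define p where "p = (\<Prod>m<n. [:- zs ! m, 1:])"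
  define V where "V = mat n n (\<lambda>(i, j). zs ! i ^ j)"
  define W where "W = mat (Suc n) (Suc n) (\<lambda>(i, j). (zs @ [w]) ! i ^ j)"
  define T where "T = four_block_mat (1\<^sub>m n) (mat n 1 (\<lambda>(j, _). coeff p j)) (0\<^sub>m 1 n) (1\<^sub>m 1)"
  have degp: "degree p = n" and monic: "coeff p n = 1"
    using degree_prod_linear[of "\<lambda>m. zs ! m" "{..<n}"]
      coeff_prod_linear_card[of "\<lambda>m. zs ! m" "{..<n}"] by (simp_all add: p_def)
  have T: "T \<in> carrier_mat (Suc n) (Suc n)"
    unfolding T_def using four_block_carrier_mat[of "1\<^sub>m n" n n "1\<^sub>m 1" 1 1] by simp
  have detT: "det T = 1"
    unfolding T_def by (subst det_four_block_mat_lower_left_zero[of _ n _ 1]) auto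
  \<comment> \<open>The corner entry 1 of \<open>T\<close> equals \<open>coeff p n\<close> because
    \<open>p\<close> is monic, so the last column consists of all coefficients of
    \<open>p\<close>.\<close>
  have Tidx: "T $$ (j, k) = (if k < n then (if j = k then 1 else 0) else coeff p j)"
    if "j < Suc n" "k < Suc n" for j k
    using that monic by (auto simp: T_def less_Suc_eq)
  have WT: "(W * T) $$ (i, k) = (if k < n then (zs @ [w]) ! i ^ k else poly p ((zs @ [w]) ! i))"
    if "i < Suc n" "k < Suc n" for i k
  proof -
    have "(W * T) $$ (i, k) = (\<Sum>j<Suc n. (zs @ [w]) ! i ^ j * T $$ (j, k))"
      using that T by (auto simp: W_def scalar_prod_def atLeast0LessThan intro!: sum.cong)
    also have "\<dots> = (\<Sum>j<Suc n. (zs @ [w]) ! i ^ j *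
        (if k < n then (if j = k then 1 else 0) else coeff p j))"
      using that Tidx by (intro sum.cong) auto
    also have "\<dots> = (if k < n then (zs @ [w]) ! i ^ k else poly p ((zs @ [w]) ! i))"
    proof (cases "k < n")
      case True
      then show ?thesis by (simp add: if_distrib[of "(*) c" for c] cong: if_cong)
    next
      case False
      then show ?thesis
        using poly_eq_sum_coeff[of p "Suc n" "(zs @ [w]) ! i"] degp
        by (simp add: mult.commute)
    qed
    finally show ?thesis .
  qed
  (* T replaces the last column by the values of p, which vanishes at all of zs. *)
  have "W * T = four_block_mat V (0\<^sub>m n 1) (mat 1 n (\<lambda>(_, j). w ^ j)) (mat 1 1 (\<lambda>_. poly p w))"
    (is "_ = ?B")
  proof (rule eq_matI)
    fix i k assume "i < dim_row ?B" "k < dim_col ?B"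
    then have "i < Suc n" "k < Suc n" by (auto simp: V_def)
    moreover have "poly p (zs ! i) = 0" if "i < n" for i
      using that unfolding p_def poly_prod_linear by (auto intro!: prod_zero)
    ultimately show "(W * T) $$ (i, k) = ?B $$ (i, k)"
      by (subst WT) (auto simp: V_def nth_append n_def less_Suc_eq)
  qed (auto simp: W_def T_def V_def)
  then have "det (W * T) = det V * poly p w"
    by (simp, subst det_four_block_mat_upper_right_zero[of _ n _ 1])
      (auto simp: V_def det_single)
  moreover have "det (W * T) = det W"
    by (subst det_mult[OF _ T]) (auto simp: W_def detT)
  ultimately have "det W = vdm zs * (\<Prod>m<n. w - zs ! m)"
    using snoc.IH by (simp add: V_def n_def p_def poly_prod)
  then show ?case by (simp add: W_def vdm_snoc n_def)
qed simp

(* Not normalised to take the value 1 at its own node: these polynomials are monic. *)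
definition lagrange_poly :: "'a::idom list \<Rightarrow> nat \<Rightarrow> 'a poly" where
  "lagrange_poly cs k = (\<Prod>m\<in>{..<length cs} - {k}. [:- cs ! m, 1:])"

lemma
  assumes "k < length cs"
  shows degree_lagrange_poly: "degree (lagrange_poly cs k) < length cs"
    and coeff_lagrange_poly_top: "coeff (lagrange_poly cs k) (length cs - 1) = 1"
    and poly_lagrange_poly:
      "poly (lagrange_poly cs k) z = (\<Prod>m\<in>{..<length cs} - {k}. z - cs ! m)"
proof -
  have card: "card ({..<length cs} - {k}) = length cs - 1" using assms by simp
  show "degree (lagrange_poly cs k) < length cs"
    unfolding lagrange_poly_def degree_prod_linear card using assms by simp
  show "coeff (lagrange_poly cs k) (length cs - 1) = 1"
    using coeff_prod_linear_card[of "\<lambda>m. cs ! m" "{..<length cs} - {k}"]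
    unfolding lagrange_poly_def card .
  show "poly (lagrange_poly cs k) z = (\<Prod>m\<in>{..<length cs} - {k}. z - cs ! m)"
    unfolding lagrange_poly_def by (rule poly_prod_linear)
qed

lemma poly_lagrange_poly_node:
  assumes "k < length cs" "m < length cs" "m \<noteq> k"
  shows "poly (lagrange_poly cs k) (cs ! m) = 0"
  unfolding poly_lagrange_poly[OF assms(1)] using assms by (auto intro!: prod_zero)

text \<open>Multiplying the coefficient matrix by the Vandermonde matrix evaluates every polynomial
  at every node. The result is diagonal, with determinant \<open>vdm cs * vdm (rev cs)\<close>, and
  \<open>vdm cs\<close> cancels.\<close>

lemma det_lagrange_coeffs:
  fixes cs :: "'a::idom list"
  assumes "vdm cs \<noteq> 0"
  shows "det (mat (length cs) (length cs) (\<lambda>(j, k). coeff (lagrange_poly cs k) j)) = vdm (rev cs)"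
    (is "det ?C = _")
proof -
  define n where "n = length cs"
  define V where "V = mat n n (\<lambda>(i, j). cs ! i ^ j)"
  have "V * ?C = mat_diag n (\<lambda>k. poly (lagrange_poly cs k) (cs ! k))"
  proof (rule eq_matI)
    fix i k assume "i < dim_row (mat_diag n (\<lambda>k. poly (lagrange_poly cs k) (cs ! k)))"
      "k < dim_col (mat_diag n (\<lambda>k. poly (lagrange_poly cs k) (cs ! k)))"
    then have ik: "i < n" "k < n" by (simp_all add: mat_diag_def)
    then have "(V * ?C) $$ (i, k) = (\<Sum>j<n. coeff (lagrange_poly cs k) j * cs ! i ^ j)"
      by (auto simp: V_def n_def scalar_prod_def atLeast0LessThan mult.commute intro!: sum.cong)
    also have "\<dots> = poly (lagrange_poly cs k) (cs ! i)"
      using degree_lagrange_poly ik by (intro poly_eq_sum_coeff) (auto simp: n_def)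
    finally show "(V * ?C) $$ (i, k) =
        mat_diag n (\<lambda>k. poly (lagrange_poly cs k) (cs ! k)) $$ (i, k)"
      using ik by (auto simp: mat_diag_def n_def poly_lagrange_poly_node)
  qed (simp_all add: mat_diag_def V_def n_def)
  moreover have "det (V * ?C) = det V * det ?C"
    by (rule det_mult[of _ n]) (auto simp: V_def n_def)
  moreover have "det V = vdm cs"
    unfolding V_def n_def by (rule det_vandermonde)
  moreover have "det (mat_diag n (\<lambda>k. poly (lagrange_poly cs k) (cs ! k)))
      = (\<Prod>k<n. poly (lagrange_poly cs k) (cs ! k))"
    by (subst det_upper_triangular[of _ n])
      (auto simp: mat_diag_def diag_mat_def upper_triangular_def prod.list_conv_set_nth
        atLeast0LessThan)
  moreover have "\<dots> = vdm cs * vdm (rev cs)"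
    unfolding prod_differences_eq_vdm[symmetric] n_def
    by (intro prod.cong) (auto simp: poly_lagrange_poly)
  ultimately show ?thesis using assms by simp
qed

section \<open>Determinants with row and column factors, rank-one terms and blocks\<close>

lemma det_scale_rows_cols:
  fixes A :: "nat \<Rightarrow> nat \<Rightarrow> 'a::comm_ring_1"
  shows "det (mat n n (\<lambda>(i, k). p i * q k * A i k))
    = (\<Prod>i<n. p i) * (\<Prod>k<n. q k) * det (mat n n (\<lambda>(i, k). A i k))"
proof -
  have "det (mat n n (\<lambda>(i, k). p i * q k * A i k))
    = (\<Sum>\<pi> | \<pi> permutes {0..<n}. signof \<pi> * (\<Prod>i=0..<n. p i * q (\<pi> i) * A i (\<pi> i)))"
    by (subst det_def'[of _ n])
      (auto intro!: sum.cong prod.cong arg_cong2[of _ _ _ _ "(*)"] simp: permutes_in_image)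
  also have "\<dots> = (\<Sum>\<pi> | \<pi> permutes {0..<n}. (\<Prod>i<n. p i) * (\<Prod>k<n. q k) *
      (signof \<pi> * (\<Prod>i=0..<n. A i (\<pi> i))))"
  proof (rule sum.cong)
    fix \<pi> assume "\<pi> \<in> {\<pi>. \<pi> permutes {0..<n}}"
    then have "(\<Prod>i=0..<n. q (\<pi> i)) = (\<Prod>k=0..<n. q k)"
      using prod.permute[of \<pi> "{0..<n}" q] by (simp add: o_def)
    then show "signof \<pi> * (\<Prod>i=0..<n. p i * q (\<pi> i) * A i (\<pi> i)) =
        (\<Prod>i<n. p i) * (\<Prod>k<n. q k) * (signof \<pi> * (\<Prod>i=0..<n. A i (\<pi> i)))"
      by (simp add: prod.distrib atLeast0LessThan)
  qed simp
  also have "\<dots> = (\<Prod>i<n. p i) * (\<Prod>k<n. q k) * det (mat n n (\<lambda>(i, k). A i k))"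
    unfolding sum_distrib_left[symmetric]
    by (subst det_def'[of "mat n n (\<lambda>(i, k). A i k)" n])
      (auto intro!: sum.cong prod.cong arg_cong2[of _ _ _ _ "(*)"] simp: permutes_in_image)
  finally show ?thesis .
qed

text \<open>The matrix determinant lemma. The bordered matrix \<open>B\<close> is reduced by two
  unitriangular factors: \<open>P\<close> clears the upper right block and leaves the n x n
  determinant, \<open>Q\<close> clears the lower left block and leaves a scalar.\<close>

lemma det_one_plus_rank_one:
  fixes u :: "nat \<Rightarrow> 'a::idom"
  shows "det (mat n n (\<lambda>(i, k). (if i = k then 1 else 0) + u i)) = 1 + (\<Sum>i<n. u i)"
proof -
  \<comment> \<open>The border has width one; the name keeps dimensions in the form
    \<open>q + n\<close> used for the blocks.\<close>
  define q where "q = (1 :: nat)"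
  define r where "r = mat q n (\<lambda>_. 1 :: 'a)"
  define U where "U = mat n q (\<lambda>(i, _). u i)"
  have [simp]: "r \<in> carrier_mat q n" "U \<in> carrier_mat n q" by (auto simp: r_def U_def)
  define B where "B = four_block_mat (1\<^sub>m q) (- r) U (1\<^sub>m n)"
  define P where "P = four_block_mat (1\<^sub>m q) r (0\<^sub>m n q) (1\<^sub>m n)"
  define Q where "Q = four_block_mat (1\<^sub>m q) (0\<^sub>m q n) (- U) (1\<^sub>m n)"
  have carrier: "B \<in> carrier_mat (q + n) (q + n)" "P \<in> carrier_mat (q + n) (q + n)"
    "Q \<in> carrier_mat (q + n) (q + n)"
    by (auto simp: B_def P_def Q_def)
  have BP: "B * P = four_block_mat (1\<^sub>m q) (0\<^sub>m q n) U (U * r + 1\<^sub>m n)"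
    unfolding B_def P_def
    by (subst mult_four_block_mat[of _ q q _ n _ n _ _ q _ n])
      (auto intro!: cong_four_block_mat eq_matI simp: r_def U_def)
  have BQ: "B * Q = four_block_mat (1\<^sub>m q + r * U) (- r) (0\<^sub>m n q) (1\<^sub>m n)"
    unfolding B_def Q_def
    by (subst mult_four_block_mat[of _ q q _ n _ n _ _ q _ n])
      (auto intro!: cong_four_block_mat eq_matI simp: r_def U_def)
  have dP: "det P = 1" unfolding P_def
    by (subst det_four_block_mat_lower_left_zero[of _ q _ n]) auto
  have dQ: "det Q = 1" unfolding Q_def
    by (subst det_four_block_mat_upper_right_zero[of _ q _ n]) auto
  have "det (U * r + 1\<^sub>m n) = det (B * P)" unfolding BP
    by (subst det_four_block_mat_upper_right_zero[of _ q _ n]) auto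
  also have "\<dots> = det (B * Q)"
    by (simp add: det_mult[OF carrier(1,2)] det_mult[OF carrier(1,3)] dP dQ)
  also have "\<dots> = det (1\<^sub>m q + r * U)" unfolding BQ
    by (subst det_four_block_mat_lower_left_zero[of _ q _ n])
      (auto intro!: add_carrier_mat mult_carrier_mat[of _ q n])
  also have "\<dots> = 1 + (\<Sum>i<n. u i)"
    by (subst det_single) (auto simp: q_def r_def U_def scalar_prod_def atLeast0LessThan)
  also have "U * r + 1\<^sub>m n = mat n n (\<lambda>(i, k). (if i = k then 1 else 0) + u i)"
    by (rule eq_matI) (auto simp: r_def U_def scalar_prod_def q_def)
  finally show ?thesis .
qed

text \<open>A Schur complement. The upper left block is a row scaling of the identity plus a
  rank-one matrix, so solving against it introduces \<open>1 / S\<close> as in the Sherman-Morrison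
  formula. This is the origin of the quotient by \<open>1 + (\<Sum>l<L. Xgf \<eta> xs f g l)\<close>
  in \<open>Sbar\<close>.\<close>

lemma det_bordered_blocks:
  fixes n :: nat and d r u \<gamma> :: "nat \<Rightarrow> 'a::field" and h h' :: "nat \<Rightarrow> nat \<Rightarrow> 'a"
  defines "S \<equiv> 1 + (\<Sum>i<n. u i)"
  assumes "S \<noteq> 0"
  shows "det (four_block_mat
      (mat n n (\<lambda>(i, k). d i * ((if i = k then 1 else 0) + u i)))
      (mat n n (\<lambda>(i, k). d i * ((if i = k then r k else 0) + u i)))
      (mat n n (\<lambda>(i, k). h i k + \<gamma> i))
      (mat n n (\<lambda>(i, k). h' i k + \<gamma> i)))
    = (\<Prod>i<n. d i) * S *
      det (mat n n (\<lambda>(i, k). h' i k - r k * h i k + (1 - r k) / S * (\<gamma> i - (\<Sum>j<n. h i j * u j))))"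
    (is "det (four_block_mat ?TL ?TR ?BL ?BR) = _ * det ?W")
proof -
  (* K is the solution of TL * K = TR, so the shear T clears the upper right block. *)
  define K where "K = mat n n (\<lambda>(j, k). (if j = k then r k else 0) + u j * ((1 - r k) / S))"
  define T where "T = four_block_mat (1\<^sub>m n) (- K) (0\<^sub>m n n) (1\<^sub>m n)"
  have [simp]: "K \<in> carrier_mat n n" by (simp add: K_def)
  have Su: "(\<Sum>i<n. u i) = S - 1" by (simp add: S_def)
  have TLK: "?TL * K = ?TR"
  proof (rule eq_matI)
    fix i k assume "i < dim_row ?TR" "k < dim_col ?TR"
    then have ik: "i < n" "k < n" by auto
    define c where "c = (1 - r k) / S"
    have "(?TL * K) $$ (i, k) = (\<Sum>j<n. d i * ((if i = j then 1 else 0) + u i) *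
        ((if j = k then r k else 0) + u j * c))"
      using ik by (simp add: K_def scalar_prod_def atLeast0LessThan c_def)
    also have "\<dots> = (\<Sum>j<n. (if i = j then d i * ((if j = k then r k else 0) + u j * c) else 0)
        + (if j = k then d i * u i * r k else 0) + d i * u i * c * u j)"
      by (intro sum.cong) (auto simp: algebra_simps)
    also have "\<dots> = d i * ((if i = k then r k else 0) + u i * c) + d i * u i * r k
        + d i * u i * c * (S - 1)"
      using ik by (simp add: sum.distrib sum_distrib_left[symmetric] Su)
    also have "\<dots> = d i * ((if i = k then r k else 0) + u i * (r k + c * S))"
      by (simp add: algebra_simps)
    \<comment> \<open>This equation is what fixes the rank-one coefficient \<open>c\<close> of
      \<open>K\<close>.\<close>
    also have "r k + c * S = 1" using assms by (simp add: c_def)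
    finally show "(?TL * K) $$ (i, k) = ?TR $$ (i, k)" using ik by simp
  qed (auto simp: K_def)
  have BLK: "?BL * - K + ?BR = ?W"
  proof (rule eq_matI)
    fix i k assume "i < dim_row ?W" "k < dim_col ?W"
    then have ik: "i < n" "k < n" by auto
    define c where "c = (1 - r k) / S"
    have r: "r k = 1 - c * S" using assms by (simp add: c_def)
    have "(?BL * K) $$ (i, k) = (\<Sum>j<n. (h i j + \<gamma> i) *
        ((if j = k then r k else 0) + u j * c))"
      using ik by (simp add: K_def scalar_prod_def atLeast0LessThan c_def)
    also have "\<dots> = (\<Sum>j<n. (if j = k then (h i k + \<gamma> i) * r k else 0)
        + c * (h i j * u j) + \<gamma> i * c * u j)"
      by (intro sum.cong) (auto simp: algebra_simps)
    also have "\<dots> = (h i k + \<gamma> i) * r k + c * (\<Sum>j<n. h i j * u j) + \<gamma> i * c * (S - 1)"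
      using ik by (simp add: sum.distrib sum_distrib_left[symmetric] Su)
    \<comment> \<open>The total coefficient of \<open>\<gamma> i\<close> is
      \<open>1 - r k - c * (S - 1)\<close>, which collapses to \<open>c\<close> since
      \<open>1 - r k = c * S\<close>.\<close>
    finally have "h' i k + \<gamma> i - (?BL * K) $$ (i, k)
        = h' i k - r k * h i k + c * (\<gamma> i - (\<Sum>j<n. h i j * u j))"
      by (simp add: r algebra_simps)
    moreover have "?BL * - K = - (?BL * K)"
      by (rule uminus_mult_right_mat) (simp add: K_def)
    ultimately show "(?BL * - K + ?BR) $$ (i, k) = ?W $$ (i, k)"
      using ik by (simp add: c_def K_def del: index_mult_mat(1))
  qed (auto simp: K_def)
  have "?TL * - K + ?TR = 0\<^sub>m n n"
    using TLK by (subst uminus_mult_right_mat) (auto intro!: eq_matI simp: K_def)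
  then have "four_block_mat ?TL ?TR ?BL ?BR * T = four_block_mat ?TL (0\<^sub>m n n) ?BL ?W"
    unfolding T_def BLK[symmetric]
    by (subst mult_four_block_mat[of _ n n _ n _ n _ _ n _ n]) auto
  moreover have "det T = 1" unfolding T_def
    by (subst det_four_block_mat_lower_left_zero[of _ n _ n]) auto
  moreover have "det (four_block_mat ?TL ?TR ?BL ?BR * T)
      = det (four_block_mat ?TL ?TR ?BL ?BR) * det T"
    by (rule det_mult[of _ "n + n"]) (auto simp: T_def)
  ultimately have "det (four_block_mat ?TL ?TR ?BL ?BR)
      = det (four_block_mat ?TL (0\<^sub>m n n) ?BL ?W)"
    by simp
  also have "\<dots> = det ?TL * det ?W"
    by (rule det_four_block_mat_upper_right_zero) auto
  also have "det ?TL = (\<Prod>i<n. d i) * S"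
    using det_scale_rows_cols[of n d "\<lambda>_. 1" "\<lambda>i k. (if i = k then 1 else 0) + u i"]
    unfolding det_one_plus_rank_one S_def by simp
  finally show ?thesis .
qed


text \<open>A row times a coefficient column is the functional of that row applied to the
  polynomial: powers turn into values, and \<open>\<gamma>\<close> survives with factor 1 because
  the polynomial is monic of degree exactly \<open>length cs - 1\<close>.\<close>

lemma sum_row_times_lagrange:
  fixes cs :: "'a::idom list"
  assumes "k < length cs"
  shows "(\<Sum>j<length cs. (\<alpha> * s ^ j + \<beta> * t ^ j + (if j + 1 = length cs then \<gamma> else 0))
      * coeff (lagrange_poly cs k) j)
    = \<alpha> * poly (lagrange_poly cs k) s + \<beta> * poly (lagrange_poly cs k) t + \<gamma>"
proof -
  let ?n = "length cs" and ?p = "lagrange_poly cs k"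
  have "(\<Sum>j<?n. (\<alpha> * s ^ j + \<beta> * t ^ j + (if j + 1 = ?n then \<gamma> else 0)) * coeff ?p j)
      = (\<Sum>j<?n. \<alpha> * (coeff ?p j * s ^ j) + \<beta> * (coeff ?p j * t ^ j)
          + (if j = ?n - 1 then \<gamma> * coeff ?p (?n - 1) else 0))"
    using assms by (intro sum.cong) (auto simp: algebra_simps)
  also have "\<dots> = \<alpha> * (\<Sum>j<?n. coeff ?p j * s ^ j) + \<beta> * (\<Sum>j<?n. coeff ?p j * t ^ j)
      + \<gamma> * coeff ?p (?n - 1)"
    using assms by (simp add: sum.distrib sum_distrib_left)
  also have "\<dots> = \<alpha> * poly ?p s + \<beta> * poly ?p t + \<gamma>"
    using poly_eq_sum_coeff[OF degree_lagrange_poly[OF assms]] coeff_lagrange_poly_top[OF assms]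
    by simp
  finally show ?thesis .
qed

section \<open>Products with a missing index, and half-shift identities for
  \<open>vsig\<close>\<close>

lemma prod_diff_singleton:
  fixes h :: "'i \<Rightarrow> 'a::comm_monoid_mult"
  assumes "finite A"
  shows "prod h (A - {k}) = (\<Prod>m\<in>A. if m = k then 1 else h m)"
  using assms by (intro prod.mono_neutral_cong_left) auto

lemma prod_lessThan_add_remove:
  fixes h :: "nat \<Rightarrow> 'a::comm_monoid_mult"
  shows "k < a \<Longrightarrow> prod h ({..<a + b} - {k}) = prod h ({..<a} - {k}) * (\<Prod>j<b. h (a + j))"
    and "k < b \<Longrightarrow>
      prod h ({..<a + b} - {a + k}) = prod h {..<a} * (\<Prod>j\<in>{..<b} - {k}. h (a + j))"
  by (simp_all add: prod_diff_singleton prod_lessThan_add cong: prod.cong_simp)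

lemma Vhat_eq_vdm: "Vhat zs = vdm (map vsig zs)"
proof -
  have "vsig a = (sinh a)\<^sup>2 + 1 / 2" for a
    unfolding vsig_def cosh_double cosh_square_eq by simp
  then show ?thesis by (simp add: Vhat_def vdm_def)
qed

text \<open>By \<open>vsig_diff\<close> both sides consist of the same four \<open>sinh\<close>
  factors, paired differently. This is how products over the shifted nodes turn into products of
  values of \<open>Xfun\<close> or \<open>Xdel\<close>.\<close>

lemma vsig_shift:
  "(vsig (y + \<eta> / 2) - vsig (x + \<eta> / 2)) * (vsig (y + \<eta> / 2) - vsig (x - \<eta> / 2))
    = (vsig y - vsig x) * (vsig (y + \<eta>) - vsig x)"
proof -
  have "y + \<eta> / 2 + (x + \<eta> / 2) = y + x + \<eta>" "y + \<eta> / 2 - (x + \<eta> / 2) = y - x"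
    "y + \<eta> / 2 + (x - \<eta> / 2) = y + x" "y + \<eta> / 2 - (x - \<eta> / 2) = y - x + \<eta>"
    "y + \<eta> + x = y + x + \<eta>" "y + \<eta> - x = y - x + \<eta>"
    by simp_all
  then show ?thesis unfolding vsig_diff by (simp only: mult_ac)
qed

lemma vsig_shift_minus:
  "(vsig (y - \<eta> / 2) - vsig (x - \<eta> / 2)) * (vsig (y - \<eta> / 2) - vsig (x + \<eta> / 2))
    = (vsig y - vsig x) * (vsig (y - \<eta>) - vsig x)"
  using vsig_shift[of y "- \<eta>" x] by simp

lemma vsig_half_shift_diff: "vsig (x + \<eta> / 2) - vsig (x - \<eta> / 2) = sinh (2 * x) * sinh \<eta>"
  by (simp add: vsig_diff)

section \<open>Node polynomials at the half-shifted parameters\<close>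

locale shifted_nodes =
  fixes \<eta> :: complex and xs :: "complex list"
begin

definition as :: "complex list" where "as = map (\<lambda>x. vsig (x - \<eta> / 2)) xs"
definition bs :: "complex list" where "bs = map (\<lambda>x. vsig (x + \<eta> / 2)) xs"

abbreviation L :: nat where "L \<equiv> length xs"
text \<open>Index k < \<open>L\<close> leaves out the node \<open>as ! k\<close>, index
  \<open>L + k\<close> the node \<open>bs ! k\<close>; this order yields the column blocks of the
  transformed matrix.\<close>

abbreviation P :: "nat \<Rightarrow> complex poly" where "P \<equiv> lagrange_poly (as @ bs)"

lemma length_as_bs [simp]: "length as = L" "length bs = L"
  by (simp_all add: as_def bs_def)

lemma nth_as_bs [simp]:
  "k < L \<Longrightarrow> as ! k = vsig (xs ! k - \<eta> / 2)" "k < L \<Longrightarrow> bs ! k = vsig (xs ! k + \<eta> / 2)"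
  by (simp_all add: as_def bs_def)

lemma poly_P_node [simp]:
  assumes "i < L" "k < L"
  shows "i \<noteq> k \<Longrightarrow> poly (P k) (vsig (xs ! i - \<eta> / 2)) = 0"
    and "poly (P k) (vsig (xs ! i + \<eta> / 2)) = 0"
    and "poly (P (L + k)) (vsig (xs ! i - \<eta> / 2)) = 0"
    and "i \<noteq> k \<Longrightarrow> poly (P (L + k)) (vsig (xs ! i + \<eta> / 2)) = 0"
  using poly_lagrange_poly_node[of k "as @ bs" i] poly_lagrange_poly_node[of k "as @ bs" "L + i"]
    poly_lagrange_poly_node[of "L + k" "as @ bs" i]
    poly_lagrange_poly_node[of "L + k" "as @ bs" "L + i"] assms
  by (auto simp: nth_append)

lemma
  assumes "k < L"
  shows poly_P_as: "poly (P k) z =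
      (\<Prod>m\<in>{..<L} - {k}. z - vsig (xs ! m - \<eta> / 2)) * (\<Prod>m<L. z - vsig (xs ! m + \<eta> / 2))"
    and poly_P_bs: "poly (P (L + k)) z =
      (\<Prod>m<L. z - vsig (xs ! m - \<eta> / 2)) * (\<Prod>m\<in>{..<L} - {k}. z - vsig (xs ! m + \<eta> / 2))"
  using assms
  by (auto simp: poly_lagrange_poly prod_lessThan_add_remove nth_append
      intro!: arg_cong2[of _ _ _ _ "(*)"] prod.cong)

text \<open>The two factors for each m other than k combine by \<open>vsig_shift_minus\<close>; the
  unpaired factor is \<open>as ! k - bs ! k\<close>. Times \<open>f (- xs ! k)\<close>, the value is
  the denominator of \<open>Xgf\<close>, sign included.\<close>

lemma poly_P_as_self:
  assumes "k < L"
  shows "poly (P k) (vsig (xs ! k - \<eta> / 2)) =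
    - (sinh (2 * xs ! k) * sinh \<eta> * Xdel xs k (xs ! k) * Xdel xs k (xs ! k - \<eta>))"
proof -
  let ?z = "vsig (xs ! k - \<eta> / 2)"
  have "poly (P k) ?z = (?z - vsig (xs ! k + \<eta> / 2)) *
      (\<Prod>m\<in>{..<L} - {k}. (?z - vsig (xs ! m - \<eta> / 2)) * (?z - vsig (xs ! m + \<eta> / 2)))"
    unfolding poly_P_as[OF assms] prod.distrib
    using assms by (simp add: prod.remove[of "{..<L}" k] mult_ac)
  also have "?z - vsig (xs ! k + \<eta> / 2) = - (sinh (2 * xs ! k) * sinh \<eta>)"
    using vsig_half_shift_diff[of "xs ! k" \<eta>] by (simp add: algebra_simps)
  finally show ?thesis
    unfolding vsig_shift_minus by (simp add: prod.distrib Xdel_def)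
qed

lemma poly_P_bs_self:
  assumes "k < L"
  shows "poly (P (L + k)) (vsig (xs ! k + \<eta> / 2)) =
    sinh (2 * xs ! k) * sinh \<eta> * Xdel xs k (xs ! k) * Xdel xs k (xs ! k + \<eta>)"
proof -
  let ?z = "vsig (xs ! k + \<eta> / 2)"
  have "poly (P (L + k)) ?z = (?z - vsig (xs ! k - \<eta> / 2)) *
      (\<Prod>m\<in>{..<L} - {k}. (?z - vsig (xs ! m + \<eta> / 2)) * (?z - vsig (xs ! m - \<eta> / 2)))"
    unfolding poly_P_bs[OF assms] prod.distrib
    using assms by (simp add: prod.remove[of "{..<L}" k] mult_ac)
  then show ?thesis
    unfolding vsig_shift vsig_half_shift_diff by (simp add: prod.distrib Xdel_def)
qed

text \<open>The Cauchy-type denominators of \<open>Sbar\<close> arise here: the product over all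
  nodes is a product of two values of \<open>Xfun\<close>, and \<open>P\<close> lacks one linear
  factor of it.\<close>

lemma poly_P_off_node:
  fixes y :: complex
  assumes "k < L"
  shows "vsig (y + \<eta> / 2) \<noteq> vsig (xs ! k - \<eta> / 2) \<Longrightarrow> poly (P k) (vsig (y + \<eta> / 2)) =
      Xfun xs y * Xfun xs (y + \<eta>) / (vsig (y + \<eta> / 2) - vsig (xs ! k - \<eta> / 2))"
    and "vsig (y - \<eta> / 2) \<noteq> vsig (xs ! k - \<eta> / 2) \<Longrightarrow> poly (P k) (vsig (y - \<eta> / 2)) =
      Xfun xs y * Xfun xs (y - \<eta>) / (vsig (y - \<eta> / 2) - vsig (xs ! k - \<eta> / 2))"
    and "vsig (y + \<eta> / 2) \<noteq> vsig (xs ! k + \<eta> / 2) \<Longrightarrow> poly (P (L + k)) (vsig (y + \<eta> / 2)) =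
      Xfun xs y * Xfun xs (y + \<eta>) / (vsig (y + \<eta> / 2) - vsig (xs ! k + \<eta> / 2))"
    and "vsig (y - \<eta> / 2) \<noteq> vsig (xs ! k + \<eta> / 2) \<Longrightarrow> poly (P (L + k)) (vsig (y - \<eta> / 2)) =
      Xfun xs y * Xfun xs (y - \<eta>) / (vsig (y - \<eta> / 2) - vsig (xs ! k + \<eta> / 2))"
proof -
  define \<Omega> where "\<Omega> z = (\<Prod>m<L. (z - vsig (xs ! m + \<eta> / 2)) * (z - vsig (xs ! m - \<eta> / 2)))" for z
  have plus: "\<Omega> (vsig (y + \<eta> / 2)) = Xfun xs y * Xfun xs (y + \<eta>)"
    unfolding \<Omega>_def vsig_shift by (simp add: prod.distrib Xfun_def)
  \<comment> \<open>For the negative shift the two kinds of nodes exchange roles, so each pair is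
    swapped to match \<open>vsig_shift_minus\<close>.\<close>
  have "\<Omega> (vsig (y - \<eta> / 2)) =
      (\<Prod>m<L. (vsig (y - \<eta> / 2) - vsig (xs ! m - \<eta> / 2)) * (vsig (y - \<eta> / 2) - vsig (xs ! m + \<eta> / 2)))"
    unfolding \<Omega>_def by (simp only: mult.commute)
  then have minus: "\<Omega> (vsig (y - \<eta> / 2)) = Xfun xs y * Xfun xs (y - \<eta>)"
    unfolding vsig_shift_minus by (simp add: prod.distrib Xfun_def)
  have as_mult: "\<Omega> z = (z - vsig (xs ! k - \<eta> / 2)) * poly (P k) z"
    and bs_mult: "\<Omega> z = (z - vsig (xs ! k + \<eta> / 2)) * poly (P (L + k)) z" for z
    unfolding \<Omega>_def poly_P_as[OF assms] poly_P_bs[OF assms] prod.distrib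
    using assms by (simp_all add: prod.remove[of "{..<L}" k] mult_ac)
  have as: "poly (P k) z = \<Omega> z / (z - vsig (xs ! k - \<eta> / 2))"
    if "z \<noteq> vsig (xs ! k - \<eta> / 2)" for z
    using that by (simp add: as_mult)
  have bs: "poly (P (L + k)) z = \<Omega> z / (z - vsig (xs ! k + \<eta> / 2))"
    if "z \<noteq> vsig (xs ! k + \<eta> / 2)" for z
    using that by (simp add: bs_mult)
  note as[of "vsig (y + \<eta> / 2)", unfolded plus] as[of "vsig (y - \<eta> / 2)", unfolded minus]
    bs[of "vsig (y + \<eta> / 2)", unfolded plus] bs[of "vsig (y - \<eta> / 2)", unfolded minus]
  then show "vsig (y + \<eta> / 2) \<noteq> vsig (xs ! k - \<eta> / 2) \<Longrightarrow> poly (P k) (vsig (y + \<eta> / 2)) =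
      Xfun xs y * Xfun xs (y + \<eta>) / (vsig (y + \<eta> / 2) - vsig (xs ! k - \<eta> / 2))"
    and "vsig (y - \<eta> / 2) \<noteq> vsig (xs ! k - \<eta> / 2) \<Longrightarrow> poly (P k) (vsig (y - \<eta> / 2)) =
      Xfun xs y * Xfun xs (y - \<eta>) / (vsig (y - \<eta> / 2) - vsig (xs ! k - \<eta> / 2))"
    and "vsig (y + \<eta> / 2) \<noteq> vsig (xs ! k + \<eta> / 2) \<Longrightarrow> poly (P (L + k)) (vsig (y + \<eta> / 2)) =
      Xfun xs y * Xfun xs (y + \<eta>) / (vsig (y + \<eta> / 2) - vsig (xs ! k + \<eta> / 2))"
    and "vsig (y - \<eta> / 2) \<noteq> vsig (xs ! k + \<eta> / 2) \<Longrightarrow> poly (P (L + k)) (vsig (y - \<eta> / 2)) =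
      Xfun xs y * Xfun xs (y - \<eta>) / (vsig (y - \<eta> / 2) - vsig (xs ! k + \<eta> / 2))"
    by blast+
qed

text \<open>The differences within \<open>as\<close> give \<open>vdm as * vdm (rev as)\<close>; the
  differences between \<open>as\<close> and \<open>bs\<close> complete
  \<open>vdm (rev as) * vdm (rev bs)\<close> to the Vandermonde product of
  \<open>rev bs @ rev as\<close>. This later cancels the determinant of the change of basis.\<close>

lemma prod_poly_P_as:
  "(\<Prod>k<L. poly (P k) (vsig (xs ! k - \<eta> / 2))) * vdm (rev bs) = vdm as * vdm (rev (as @ bs))"
proof -
  have "(\<Prod>k<L. poly (P k) (vsig (xs ! k - \<eta> / 2)))
      = (\<Prod>k<length as. \<Prod>m\<in>{..<length as} - {k}. as ! k - as ! m)
        * (\<Prod>k<L. \<Prod>m<L. as ! k - bs ! m)"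
    by (simp add: poly_P_as prod.distrib)
  also have "\<dots> = vdm as * vdm (rev as) * (\<Prod>k<L. \<Prod>m<L. as ! k - bs ! m)"
    unfolding prod_differences_eq_vdm ..
  \<comment> \<open>Reversal only permutes the factors; the new order is that of the cross term in
    \<open>vdm_append\<close>.\<close>
  also have "(\<Prod>k<L. \<Prod>m<L. as ! k - bs ! m) = (\<Prod>k<L. \<Prod>m<L. rev as ! k - rev bs ! m)"
    using prod_rev_nth[of "\<lambda>a. \<Prod>m<L. a - bs ! m" as]
      prod_rev_nth[of "\<lambda>b. a - b" bs for a] by simp
  finally show ?thesis
    by (simp add: vdm_append)
qed

text \<open>Read off from \<open>prod_poly_P_as\<close>: its left side is nonzero, and its right
  side contains \<open>vdm (as @ bs)\<close> up to sign.\<close>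

lemma vdm_nodes_nonzero:
  assumes "vdm bs \<noteq> 0" "sinh \<eta> \<noteq> 0" "\<And>k. k < L \<Longrightarrow> sinh (2 * xs ! k) \<noteq> 0"
    and "\<And>k. k < L \<Longrightarrow> Xdel xs k (xs ! k) \<noteq> 0"
    and "\<And>k. k < L \<Longrightarrow> Xdel xs k (xs ! k - \<eta>) \<noteq> 0"
  shows "vdm (as @ bs) \<noteq> 0"
proof -
  have "poly (P k) (vsig (xs ! k - \<eta> / 2)) \<noteq> 0" if "k < L" for k
    using that assms by (simp add: poly_P_as_self)
  then have "(\<Prod>k<L. poly (P k) (vsig (xs ! k - \<eta> / 2))) * vdm (rev bs) \<noteq> 0"
    using assms(1) by (simp add: vdm_rev)
  then show ?thesis
    unfolding prod_poly_P_as by (simp add: vdm_rev del: rev_append)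
qed

text \<open>The \<open>sinh\<close> quotient in \<open>phi\<close> cancels the k-th factors of the
  two values of \<open>Xfun\<close>; the sign comes from \<open>sinh (- \<eta>)\<close>. Thus
  \<open>phi\<close> carries the value of \<open>P k\<close> at its own node to that of
  \<open>P (L + k)\<close>.\<close>

lemma phi_eq:
  assumes "k < L" "sinh \<eta> \<noteq> 0" "sinh (2 * xs ! k + \<eta>) \<noteq> 0" "Xfun xs (xs ! k - \<eta>) \<noteq> 0"
  shows "phi \<eta> xs (xs ! k) * Xdel xs k (xs ! k - \<eta>) = - Xdel xs k (xs ! k + \<eta>)"
proof -
  have "xs ! k - \<eta> + xs ! k = 2 * xs ! k - \<eta>" "xs ! k + \<eta> + xs ! k = 2 * xs ! k + \<eta>" by simp_all
  then have "Xfun xs (xs ! k - \<eta>) = - (sinh (2 * xs ! k - \<eta>) * sinh \<eta> * Xdel xs k (xs ! k - \<eta>))"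
    and "Xfun xs (xs ! k + \<eta>) = sinh (2 * xs ! k + \<eta>) * sinh \<eta> * Xdel xs k (xs ! k + \<eta>)"
    by (simp_all add: Xfun_remove[OF assms(1)] vsig_diff)
  then show ?thesis
    using assms unfolding phi_def by (auto simp: divide_simps)
qed

end

section \<open>Reduction of the 2L x 2L determinant to that of \<open>Sbar\<close>\<close>

lemma Vhat_append:
  assumes "length xs = L" "length ys = L"
  shows "Vhat (xs @ ys) = Vhat xs * Vhat ys * (\<Prod>i<L. Xfun xs (ys ! i))"
  by (simp add: Vhat_eq_vdm vdm_append Xfun_def assms)

text \<open>Matches an entry of \<open>Sbar\<close> with one of the Schur complement, where r = q /
  F: the row factor \<open>1 / X\<close> and the column factor \<open>F\<close> come out. The
  letters \<open>pa\<close>, \<open>pb\<close>, \<open>sa\<close> belong to the shift by +\<eta>/2,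
  and \<open>qa\<close>, \<open>qb\<close>, \<open>sb\<close> to -\<eta>/2.\<close>

lemma Sbar_entry:
  fixes F q S X \<alpha> \<beta> pa pb qa qb sa sb \<gamma> :: complex
  assumes "F \<noteq> 0" "X \<noteq> 0" "S \<noteq> 0"
  shows "\<alpha> * (F * pb - q * pa - (F - q) / S * sa) + \<beta> * (F * qb - q * qa - (F - q) / S * sb)
      + \<gamma> / X * ((F - q) / S)
    = 1 / X * F * (X * (\<alpha> * pb + \<beta> * qb) - q / F * (X * (\<alpha> * pa + \<beta> * qa))
      + (1 - q / F) / S * (\<gamma> - X * (\<alpha> * sa + \<beta> * sb)))"
  using assms by (simp add: field_simps)

theorem mainTheorem10:
  fixes \<eta> :: complex and L :: nat and xs ys :: "complex list"
    and f g :: "complex \<Rightarrow> complex"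
  assumes "length xs = L" and "length ys = L"
    and "Vhat (xs @ ys) \<noteq> 0"
    and "Vhat (map (\<lambda>x. x + \<eta> / 2) xs) \<noteq> 0"
    and "Vhat (rev xs) \<noteq> 0" and "Vhat ys \<noteq> 0"
    and "sinh \<eta> \<noteq> 0"
    and "\<And>k. k < L \<Longrightarrow> sinh (2 * xs ! k) \<noteq> 0"
    and "\<And>k. k < L \<Longrightarrow> sinh (2 * xs ! k + \<eta>) \<noteq> 0"
    and "\<And>k. k < L \<Longrightarrow> f (- xs ! k) \<noteq> 0"
    and "\<And>k. k < L \<Longrightarrow> Xdel xs k (xs ! k) \<noteq> 0"
    and "\<And>k. k < L \<Longrightarrow> Xdel xs k (xs ! k - \<eta>) \<noteq> 0"
    and "\<And>k. k < L \<Longrightarrow> Xfun xs (xs ! k - \<eta>) \<noteq> 0"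
    and "\<And>i. i < L \<Longrightarrow> Xfun xs (ys ! i) \<noteq> 0"
    and "1 + (\<Sum>k<L. Xgf \<eta> xs f g k) \<noteq> 0"
    and "\<And>i k \<epsilon>. i < L \<Longrightarrow> k < L \<Longrightarrow> \<epsilon> \<in> {1, -1} \<Longrightarrow>
           vsig (ys ! i + \<epsilon> * \<eta> / 2) - vsig (xs ! k + \<eta> / 2) \<noteq> 0"
    and "\<And>i k \<epsilon>. i < L \<Longrightarrow> k < L \<Longrightarrow> \<epsilon> \<in> {1, -1} \<Longrightarrow>
           vsig (ys ! i + \<epsilon> * \<eta> / 2) - vsig (xs ! k - \<eta> / 2) \<noteq> 0"
  shows "Adet \<eta> (xs @ ys) f g =
    Vhat (map (\<lambda>x. x - \<eta> / 2) xs) / Vhat (map (\<lambda>x. x + \<eta> / 2) xs)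
    * (1 + (\<Sum>k<L. Xgf \<eta> xs f g k))
    * (det (Sbar \<eta> xs ys f g) / (Vhat (rev xs) * Vhat ys))"
proof -
  interpret shifted_nodes \<eta> xs .
  define M where "M = mat (L + L) (L + L) (\<lambda>(i, j).
    (\<Sum>\<epsilon>\<in>{1, -1}. f (\<epsilon> * (xs @ ys) ! i) * vsig ((xs @ ys) ! i + \<epsilon> * \<eta> / 2) ^ j)
       + (if j + 1 = L + L then g ((xs @ ys) ! i) else 0))"
  define C where "C = mat (L + L) (L + L) (\<lambda>(j, k). coeff (P k) j)"
  define F where "F k = f (- xs ! k)" for k
  define q where "q k = f (xs ! k) * phi \<eta> xs (xs ! k)" for k
  define d where "d k = F k * poly (P k) (vsig (xs ! k - \<eta> / 2))" for k
  define r where "r k = q k / F k" for k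
  define u where "u k = Xgf \<eta> xs f g k" for k
  define S where "S = 1 + (\<Sum>k<L. u k)"
  define X where "X i = Xfun xs (ys ! i)" for i
  define \<alpha> where "\<alpha> i = f (ys ! i) * Xfun xs (ys ! i + \<eta>)" for i
  define \<beta> where "\<beta> i = f (- ys ! i) * Xfun xs (ys ! i - \<eta>)" for i
  \<comment> \<open>\<open>h\<close> and \<open>h'\<close> are the contributions of \<open>f\<close>
    to the y-rows on the columns \<open>P k\<close> and \<open>P (L + k)\<close>.\<close>
  define h where "h i k = X i * (\<alpha> i / (vsig (ys ! i + \<eta> / 2) - vsig (xs ! k - \<eta> / 2))
    + \<beta> i / (vsig (ys ! i - \<eta> / 2) - vsig (xs ! k - \<eta> / 2)))" for i k
  define h' where "h' i k = X i * (\<alpha> i / (vsig (ys ! i + \<eta> / 2) - vsig (xs ! k + \<eta> / 2))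
    + \<beta> i / (vsig (ys ! i - \<eta> / 2) - vsig (xs ! k + \<eta> / 2)))" for i k
  define W where "W = mat L L (\<lambda>(i, k).
    h' i k - r k * h i k + (1 - r k) / S * (g (ys ! i) - (\<Sum>j<L. h i j * u j)))"
  have len [simp]: "length xs = L" "length ys = L" by (fact assms)+
  note P_node [simp] = poly_P_node[unfolded len]
  note P_off_node = poly_P_off_node[unfolded len]
  have F: "F k \<noteq> 0" if "k < L" for k using assms(10) that by (simp add: F_def)
  have X: "X i \<noteq> 0" if "i < L" for i using assms(14) that by (simp add: X_def)
  have S: "S \<noteq> 0" using assms(15) by (simp add: S_def u_def)
  have ne: "vsig (ys ! i + \<eta> / 2) \<noteq> vsig (xs ! k + \<eta> / 2)"
    "vsig (ys ! i - \<eta> / 2) \<noteq> vsig (xs ! k + \<eta> / 2)"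
    "vsig (ys ! i + \<eta> / 2) \<noteq> vsig (xs ! k - \<eta> / 2)"
    "vsig (ys ! i - \<eta> / 2) \<noteq> vsig (xs ! k - \<eta> / 2)" if "i < L" "k < L" for i k
    using assms(16,17)[OF that, of 1] assms(16,17)[OF that, of "-1"] by simp_all
  have du: "d k * u k = g (xs ! k)" if "k < L" for k
    using that assms(7,8,10,11,12)
    by (simp add: d_def u_def F_def poly_P_as_self Xgf_def)
  have dr: "d k * r k = f (xs ! k) * poly (P (L + k)) (vsig (xs ! k + \<eta> / 2))" if "k < L" for k
  proof -
    have "d k * r k = - (f (xs ! k) * (sinh (2 * xs ! k) * sinh \<eta> * Xdel xs k (xs ! k)
        * (phi \<eta> xs (xs ! k) * Xdel xs k (xs ! k - \<eta>))))"
      using that F[OF that] by (simp add: d_def r_def q_def poly_P_as_self)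
    then show ?thesis
      using that assms(7,9,13) poly_P_bs_self[of k] by (simp add: phi_eq)
  qed
  have MC: "(M * C) $$ (i, k) =
      f ((xs @ ys) ! i) * poly (P k) (vsig ((xs @ ys) ! i + \<eta> / 2))
      + f (- (xs @ ys) ! i) * poly (P k) (vsig ((xs @ ys) ! i - \<eta> / 2)) + g ((xs @ ys) ! i)"
    if "i < L + L" "k < L + L" for i k
    using that sum_row_times_lagrange[of k "as @ bs" "f ((xs @ ys) ! i)"
        "vsig ((xs @ ys) ! i + \<eta> / 2)" "f (- (xs @ ys) ! i)"
        "vsig ((xs @ ys) ! i - \<eta> / 2)" "g ((xs @ ys) ! i)"]
    by (simp add: M_def C_def scalar_prod_def atLeast0LessThan)
  \<comment> \<open>In the row of x_i, \<open>f (- xs ! i)\<close> multiplies the value at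
    \<open>as ! i\<close> and \<open>f (xs ! i)\<close> the value at \<open>bs ! i\<close>, so these
    terms are diagonal in each block. The g-term is the same in all columns and equals
    \<open>d i * u i\<close> by \<open>du\<close>.\<close>
  have "M * C = four_block_mat
      (mat L L (\<lambda>(i, k). d i * ((if i = k then 1 else 0) + u i)))
      (mat L L (\<lambda>(i, k). d i * ((if i = k then r k else 0) + u i)))
      (mat L L (\<lambda>(i, k). h i k + g (ys ! i)))
      (mat L L (\<lambda>(i, k). h' i k + g (ys ! i)))" (is "_ = ?B")
  proof (rule eq_matI)
    fix i k assume "i < dim_row ?B" "k < dim_col ?B"
    then have "i < L + L" "k < L + L" by simp_all
    moreover obtain i' where "i < L \<and> i' = i \<or> i = L + i'" by (metis le_Suc_ex not_less)
    moreover obtain k' where "k < L \<and> k' = k \<or> k = L + k'" by (metis le_Suc_ex not_less)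
    ultimately consider "i < L" "k < L" | "i < L" "k = L + k'" "k' < L"
      | "i = L + i'" "i' < L" "k < L" | "i = L + i'" "i' < L" "k = L + k'" "k' < L"
      by auto
    then show "(M * C) $$ (i, k) = ?B $$ (i, k)"
    proof cases
      case 1
      then show ?thesis
        by (subst MC) (auto simp: nth_append distrib_left d_def F_def du[unfolded d_def F_def])
    next
      case 2
      then show ?thesis
        by (subst MC) (auto simp: nth_append distrib_left du dr)
    next
      case 3
      then show ?thesis
        by (subst MC)
          (auto simp: nth_append P_off_node ne h_def X_def \<alpha>_def \<beta>_def algebra_simps)
    next
      case 4
      then show ?thesis
        by (subst MC)
          (auto simp: nth_append P_off_node ne h'_def X_def \<alpha>_def \<beta>_def algebra_simps)
    qed
  qed (simp_all add: M_def C_def)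
  then have "det (M * C) = (\<Prod>i<L. d i) * S * det W"
    using det_bordered_blocks[of u L d r h "\<lambda>i. g (ys ! i)" h'] S by (simp add: S_def W_def)
  moreover have "det (M * C) = det M * det C"
    by (rule det_mult[of _ "L + L"]) (auto simp: M_def C_def)
  moreover have vdm_bs: "vdm bs = Vhat (map (\<lambda>x. x + \<eta> / 2) xs)"
    by (simp add: Vhat_eq_vdm bs_def o_def)
  then have vdm_nodes: "vdm (as @ bs) \<noteq> 0"
    using assms(4,7,8,11,12) by (intro vdm_nodes_nonzero) auto
  then have "det C = vdm (rev (as @ bs))"
    using det_lagrange_coeffs[of "as @ bs"] by (simp add: C_def)
  \<comment> \<open>The extra factor \<open>vdm (rev bs)\<close> makes \<open>prod_poly_P_as\<close>
    applicable, after which \<open>vdm (rev (as @ bs))\<close> cancels.\<close>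
  ultimately have "det M * vdm (rev (as @ bs)) * vdm (rev bs) = (\<Prod>i<L. d i) * vdm (rev bs) * S * det W"
    by simp
  also have "(\<Prod>i<L. d i) * vdm (rev bs) = (\<Prod>i<L. F i) * vdm as * vdm (rev (as @ bs))"
    using prod_poly_P_as by (simp add: d_def prod.distrib mult.assoc)
  finally have detM: "det M * vdm (rev bs) = (\<Prod>i<L. F i) * vdm as * S * det W"
    using vdm_nodes by (simp add: vdm_rev del: rev_append)
  have "Sbar \<eta> xs ys f g = mat L L (\<lambda>(i, k). 1 / X i * F k *
    (h' i k - r k * h i k + (1 - r k) / S * (g (ys ! i) - (\<Sum>j<L. h i j * u j))))"
  proof (rule eq_matI, goal_cases)
    case (1 i k)
    then have ik: "i < L" "k < L" by simp_all
    define sa where "sa = (\<Sum>j<L. u j / (vsig (ys ! i + \<eta> / 2) - vsig (xs ! j - \<eta> / 2)))"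
    define sb where "sb = (\<Sum>j<L. u j / (vsig (ys ! i - \<eta> / 2) - vsig (xs ! j - \<eta> / 2)))"
    have sum_h: "(\<Sum>j<L. h i j * u j) = X i * (\<alpha> i * sa + \<beta> i * sb)"
      by (simp add: sa_def sb_def h_def sum_distrib_left sum.distrib[symmetric] algebra_simps)
    \<comment> \<open>The reciprocals are kept as separate factors so that the entry has the shape
      of the left side of \<open>Sbar_entry\<close>.\<close>
    have "Sbar \<eta> xs ys f g $$ (i, k) =
        \<alpha> i * (F k * (1 / (vsig (ys ! i + \<eta> / 2) - vsig (xs ! k + \<eta> / 2)))
          - q k * (1 / (vsig (ys ! i + \<eta> / 2) - vsig (xs ! k - \<eta> / 2))) - (F k - q k) / S * sa)
        + \<beta> i * (F k * (1 / (vsig (ys ! i - \<eta> / 2) - vsig (xs ! k + \<eta> / 2)))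
          - q k * (1 / (vsig (ys ! i - \<eta> / 2) - vsig (xs ! k - \<eta> / 2))) - (F k - q k) / S * sb)
        + g (ys ! i) / X i * ((F k - q k) / S)"
      using ik by (simp add: Sbar_def \<alpha>_def \<beta>_def F_def q_def S_def u_def X_def sa_def sb_def)
    then show ?case
      unfolding Sbar_entry[OF F[OF ik(2)] X[OF ik(1)] S]
      using ik by (simp add: sum_h) (simp add: h_def h'_def r_def)
  qed (simp_all add: Sbar_def)
  then have detS: "det (Sbar \<eta> xs ys f g) = (\<Prod>i<L. 1 / X i) * (\<Prod>k<L. F k) * det W"
    by (simp only: det_scale_rows_cols W_def)
  \<comment> \<open>The row factors of \<open>Sbar\<close> cancel the cross terms of
    \<open>Vhat (xs @ ys)\<close>.\<close>
  have prodX: "(\<Prod>i<L. 1 / X i) * (\<Prod>i<L. X i) = 1"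
    using X by (simp add: prod.distrib[symmetric])
  have adet: "Adet \<eta> (xs @ ys) f g = det M / (Vhat xs * Vhat ys * (\<Prod>i<L. X i))"
    by (simp add: Adet_def M_def Vhat_append X_def mult_2)
  \<comment> \<open>Both \<open>rev xs\<close> and \<open>rev bs\<close> have length
    \<open>L\<close>, so the same sign occurs in \<open>Vhat (rev xs)\<close> and
    \<open>vdm (rev bs)\<close> and drops out.\<close>
  define s :: complex where "s = (\<Prod>k<L. (-1) ^ k)"
  have "s \<noteq> 0" by (simp add: s_def)
  moreover have "Vhat (rev xs) = s * Vhat xs" "vdm (rev bs) = s * vdm bs"
    by (simp_all add: Vhat_eq_vdm rev_map[symmetric] vdm_rev s_def)
  moreover have "Vhat (map (\<lambda>x. x - \<eta> / 2) xs) = vdm as"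
    by (simp add: Vhat_eq_vdm as_def o_def)
  moreover have "Vhat xs \<noteq> 0" "(\<Prod>i<L. X i) \<noteq> 0" using assms(3) by (auto simp: Vhat_append X_def)
  moreover have "det M * (s * vdm bs) = vdm as * S * (det (Sbar \<eta> xs ys f g) * (\<Prod>i<L. X i))"
    using detM prodX \<open>vdm (rev bs) = s * vdm bs\<close> unfolding detS by (simp add: mult_ac)
  ultimately show ?thesis
    using assms(4,6) unfolding adet vdm_bs[symmetric] u_def[symmetric] S_def[symmetric]
    by (simp add: divide_simps) (simp only: mult_ac)
qed

end
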